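(* Let $k\ge 3$ and $s$ be natural numbers, let $c_1,\ldots,c_s$ and $n$ be non-zero integers, and let $y_1,\ldots ,y_s$ be non-zero integers satisfying $c_1y_1^k+\ldots +c_sy_s^k=n$. Let $K$ be either $\mathbb R$ or $\mathbb Q_p$ for some prime number $p$, and let $\mathbf z\in K^s$ be a solution of the system $$\sum_{i=1}^sc_iy_i^{k-j}z_i^j=0\quad (1\le j\le k).$$ (i) If $\mathbf y$ satisfies the condition that there be no vanishing subsums, and $\mathbf z\ne\mathbf 0$, then $\mathbf z$ is a non-singular solution of the system. (ii) If $z_i\ne 0$ for all $1\le i\le s$, then $\mathbf z$ is a non-singular solution of the system (with no further condition on $\mathbf y$).
   Context: The $s$-tuple $\mathbf y$ satisfies the condition that there be no vanishing subsums if, for each $r\ge 1$, there is no $r$-tuple of indices $1\le i_1<i_2<\ldots <i_r\le s$ for which $c_{i_1}y_{i_1}^k+\ldots +c_{i_r}y_{i_r}^k=0$. A solution $\mathbf z\in K^s$ of the system is non-singular if the $k\times s$ Jacobian matrix $\bigl(jc_iy_i^{k-j}z_i^{j-1}\bigr)_{1\le j\le k,\,1\le i\le s}$ has rank $k$ over $K$. *)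

theory Defs
  imports
    Complex_Main
    "Jordan_Normal_Form.DL_Rank"
    "Berlekamp_Zassenhaus.Finite_Field"
begin

section \<open>The \<open>p\<close>-adic absolute value on the rationals\<close>

definition padic_abs :: "nat \<Rightarrow> rat \<Rightarrow> real" where
  "padic_abs p x = (if x = 0 then 0 else
     real p powi (int (multiplicity (int p) (snd (quotient_of x)))
                - int (multiplicity (int p) (fst (quotient_of x)))))"

lemma padic_abs_zero [simp]: "padic_abs p 0 = 0"
  by (simp add: padic_abs_def)

context
  fixes p :: nat
  assumes p: "prime p"
begin

lemma padic_abs_frac:
  assumes "a \<noteq> 0" "b \<noteq> 0"
  shows "padic_abs p (of_int a / of_int b)
       = real p ^ multiplicity (int p) b / real p ^ multiplicity (int p) a"
proof -
  obtain a' b' where q: "quotient_of (of_int a / of_int b) = (a', b')"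
    by fastforce
  have b': "b' > 0" using quotient_of_denom_pos[OF q] .
  have eq: "(of_int a / of_int b :: rat) = of_int a' / of_int b'"
    using quotient_of_div[OF q] .
  have a': "a' \<noteq> 0" using eq assms by auto
  have "(of_int (a * b') :: rat) = of_int (a' * b)"
    using eq b' assms by (simp add: field_simps)
  then have ab: "a * b' = a' * b" by (simp only: of_int_eq_iff)
  have pe: "prime_elem (int p)" using p by simp
  have "multiplicity (int p) (a * b') = multiplicity (int p) (a' * b)"
    using ab by simp
  then have m: "multiplicity (int p) a + multiplicity (int p) b'
              = multiplicity (int p) a' + multiplicity (int p) b"
    using pe a' b' assms by (simp add: prime_elem_multiplicity_mult_distrib)
  have p0: "real p \<noteq> 0" using p by (auto simp: prime_gt_0_nat)
  have e: "int (multiplicity (int p) b') - int (multiplicity (int p) a')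
      = int (multiplicity (int p) b) - int (multiplicity (int p) a)"
    using m by linarith
  have "padic_abs p (of_int a / of_int b)
      = real p powi (int (multiplicity (int p) b) - int (multiplicity (int p) a))"
    using assms q e by (simp add: padic_abs_def)
  also have "\<dots> = real p ^ multiplicity (int p) b / real p ^ multiplicity (int p) a"
    using p0 by (simp add: power_int_diff)
  finally show ?thesis .
qed

lemma rat_frac_cases:
  fixes x :: rat
  obtains a b :: int where "b \<noteq> 0" "x = of_int a / of_int b"
proof -
  obtain a b where q: "quotient_of x = (a, b)" by fastforce
  show thesis
    using that[of b a] quotient_of_div[OF q] quotient_of_denom_pos[OF q] by simp
qed

lemma padic_abs_pos: "x \<noteq> 0 \<Longrightarrow> padic_abs p x > 0"
  using prime_gt_0_nat[OF p] by (simp add: padic_abs_def)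

lemma padic_abs_eq_0 [simp]: "padic_abs p x = 0 \<longleftrightarrow> x = 0"
  using padic_abs_pos[of x] by (cases "x = 0") auto

lemma padic_abs_nonneg [simp]: "padic_abs p x \<ge> 0"
  using padic_abs_pos[of x] by (cases "x = 0") auto

lemma padic_abs_one [simp]: "padic_abs p 1 = 1"
  using padic_abs_frac[of 1 1] by simp

lemma padic_abs_mult: "padic_abs p (x * y) = padic_abs p x * padic_abs p y"
proof (cases "x = 0 \<or> y = 0")
  case False
  obtain a b where x: "b \<noteq> 0" "x = of_int a / of_int b" by (rule rat_frac_cases)
  obtain c d where y: "d \<noteq> 0" "y = of_int c / of_int d" by (rule rat_frac_cases)
  have nz: "a \<noteq> 0" "c \<noteq> 0" using False x y by auto
  have "x * y = of_int (a * c) / of_int (b * d)" using x y by simp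
  then have "padic_abs p (x * y)
     = real p ^ multiplicity (int p) (b * d) / real p ^ multiplicity (int p) (a * c)"
    using padic_abs_frac[of "a * c" "b * d"] nz x y by simp
  also have "\<dots> = padic_abs p x * padic_abs p y"
    using p nz x(1) y(1) unfolding x(2) y(2)
    by (simp add: padic_abs_frac prime_elem_multiplicity_mult_distrib power_add)
  finally show ?thesis .
qed auto

lemma padic_abs_minus [simp]: "padic_abs p (- x) = padic_abs p x"
proof -
  have "padic_abs p (-1) * padic_abs p (-1) = 1"
    using padic_abs_mult[of "-1" "-1"] by simp
  then have "padic_abs p (-1) = 1"
    using padic_abs_nonneg[of "-1"]
    by (metis abs_of_nonneg real_sqrt_abs2 real_sqrt_one)
  then show ?thesis using padic_abs_mult[of "-1" x] by simp
qed

lemma padic_abs_minus_commute: "padic_abs p (x - y) = padic_abs p (y - x)"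
  using padic_abs_minus[of "x - y"] by simp

lemma padic_abs_inverse: "padic_abs p (inverse x) = inverse (padic_abs p x)"
proof (cases "x = 0")
  case False
  then have "padic_abs p (inverse x) * padic_abs p x = 1"
    using padic_abs_mult[of "inverse x" x] by simp
  then show ?thesis by (metis inverse_unique mult.commute)
qed auto

lemma padic_abs_add: "padic_abs p (x + y) \<le> max (padic_abs p x) (padic_abs p y)"
proof (cases "x = 0 \<or> y = 0 \<or> x + y = 0")
  case True
  then show ?thesis by (auto simp: max_def)
next
  case False
  obtain a b where x: "b \<noteq> 0" "x = of_int a / of_int b" by (rule rat_frac_cases)
  obtain c d where y: "d \<noteq> 0" "y = of_int c / of_int d" by (rule rat_frac_cases)
  let ?m = "multiplicity (int p)" and ?u = "a * d" and ?v = "c * b"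
  have nz: "a \<noteq> 0" "c \<noteq> 0" using False x y by auto
  have s: "x + y = of_int (?u + ?v) / of_int (b * d)"
    using x y by (simp add: field_simps)
  have snz: "?u + ?v \<noteq> 0"
  proof
    assume "?u + ?v = 0"
    then have "x + y = 0" unfolding s by (simp only: of_int_0 div_0)
    then show False using False by simp
  qed
  have xu: "x = of_int ?u / of_int (b * d)" and yv: "y = of_int ?v / of_int (b * d)"
    using x y by (simp_all add: field_simps)
  have "int p ^ min (?m ?u) (?m ?v) dvd ?u + ?v"
    by (intro dvd_add multiplicity_dvd') auto
  then have mm: "min (?m ?u) (?m ?v) \<le> ?m (?u + ?v)"
    using snz p by (intro multiplicity_geI) auto
  have p1: "real p > 1" using p prime_gt_1_nat by auto
  have key: "real p ^ ?m (b * d) / real p ^ ?m (?u + ?v)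
      \<le> real p ^ ?m (b * d) / real p ^ w" if "w \<le> ?m (?u + ?v)" for w
    using p1 that by (intro divide_left_mono power_increasing) auto
  have ax: "padic_abs p x = real p ^ ?m (b * d) / real p ^ ?m ?u"
    unfolding xu using nz x(1) y(1) by (intro padic_abs_frac) auto
  have ay: "padic_abs p y = real p ^ ?m (b * d) / real p ^ ?m ?v"
    unfolding yv using nz x(1) y(1) by (intro padic_abs_frac) auto
  have as: "padic_abs p (x + y) = real p ^ ?m (b * d) / real p ^ ?m (?u + ?v)"
    unfolding s using snz x(1) y(1) by (intro padic_abs_frac) auto
  show ?thesis
  proof (cases "?m ?u \<le> ?m ?v")
    case True
    then have "padic_abs p (x + y) \<le> padic_abs p x" using mm key ax as by auto
    then show ?thesis by simp
  next
    case False
    then have "padic_abs p (x + y) \<le> padic_abs p y" using mm key ay as by auto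
    then show ?thesis by simp
  qed
qed

lemma padic_abs_add_less:
  "padic_abs p x < e \<Longrightarrow> padic_abs p y < e \<Longrightarrow> padic_abs p (x + y) < e"
  using padic_abs_add[of x y] by auto

lemma padic_abs_triangle: "padic_abs p (x + y) \<le> padic_abs p x + padic_abs p y"
  using padic_abs_add[of x y] padic_abs_nonneg[of x] padic_abs_nonneg[of y] by linarith

end


section \<open>Cauchy sequences and null sequences\<close>

definition padic_cauchy :: "nat \<Rightarrow> (nat \<Rightarrow> rat) \<Rightarrow> bool" where
  "padic_cauchy p X \<longleftrightarrow> (\<forall>e>0. \<exists>N. \<forall>m\<ge>N. \<forall>n\<ge>N. padic_abs p (X m - X n) < e)"

definition padic_null :: "nat \<Rightarrow> (nat \<Rightarrow> rat) \<Rightarrow> bool" where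
  "padic_null p X \<longleftrightarrow> (\<forall>e>0. \<exists>N. \<forall>n\<ge>N. padic_abs p (X n) < e)"

definition padic_rel :: "nat \<Rightarrow> (nat \<Rightarrow> rat) \<Rightarrow> (nat \<Rightarrow> rat) \<Rightarrow> bool" where
  "padic_rel p X Y \<longleftrightarrow> padic_cauchy p X \<and> padic_cauchy p Y \<and> padic_null p (\<lambda>n. X n - Y n)"

context
  fixes p :: nat
  assumes p: "prime p"
begin

lemma padic_cauchy_const: "padic_cauchy p (\<lambda>_. x)"
  by (auto simp: padic_cauchy_def)

lemma padic_null_const_iff: "padic_null p (\<lambda>_. x) \<longleftrightarrow> x = 0"
proof
  assume n: "padic_null p (\<lambda>_. x)"
  show "x = 0"
  proof (rule ccontr)
    assume "x \<noteq> 0"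
    then have "padic_abs p x > 0" by (rule padic_abs_pos[OF p])
    then show False using n unfolding padic_null_def by (metis order_refl order_less_irrefl)
  qed
qed (auto simp: padic_null_def)

lemma padic_null_add:
  assumes "padic_null p X" "padic_null p Y"
  shows "padic_null p (\<lambda>n. X n + Y n)"
  unfolding padic_null_def
proof (intro allI impI)
  fix e :: real assume e: "e > 0"
  obtain M where "\<forall>n\<ge>M. padic_abs p (X n) < e"
    using assms(1) e unfolding padic_null_def by blast
  moreover obtain N where "\<forall>n\<ge>N. padic_abs p (Y n) < e"
    using assms(2) e unfolding padic_null_def by blast
  ultimately have "\<forall>n\<ge>max M N. padic_abs p (X n + Y n) < e"
    using padic_abs_add_less[OF p] by simp
  then show "\<exists>N. \<forall>n\<ge>N. padic_abs p (X n + Y n) < e" ..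
qed

lemma padic_null_minus: "padic_null p X \<Longrightarrow> padic_null p (\<lambda>n. - X n)"
  by (simp add: padic_null_def p)

lemma padic_null_diff:
  "padic_null p X \<Longrightarrow> padic_null p Y \<Longrightarrow> padic_null p (\<lambda>n. X n - Y n)"
  using padic_null_add[OF _ padic_null_minus, of X Y] by simp

lemma padic_null_diff_commute:
  "padic_null p (\<lambda>n. X n - Y n) \<Longrightarrow> padic_null p (\<lambda>n. Y n - X n)"
  by (simp add: padic_null_def padic_abs_minus_commute[OF p, of "X _"])

lemma padic_null_mult_bounded:
  assumes "padic_null p X" and B: "B > 0" "\<forall>n\<ge>M. padic_abs p (Y n) \<le> B"
  shows "padic_null p (\<lambda>n. X n * Y n)"
  unfolding padic_null_def
proof (intro allI impI)
  fix e :: real assume e: "e > 0"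
  then have "e / B > 0" using B by simp
  then obtain N where N: "\<forall>n\<ge>N. padic_abs p (X n) < e / B"
    using assms(1) unfolding padic_null_def by blast
  have "padic_abs p (X n * Y n) < e" if n: "n \<ge> max M N" for n
  proof -
    have "padic_abs p (X n) * padic_abs p (Y n) \<le> padic_abs p (X n) * B"
      using B n by (intro mult_left_mono) (auto simp: p)
    also have "\<dots> < e" using N n B(1) by (simp add: field_simps)
    finally show ?thesis by (simp add: padic_abs_mult[OF p])
  qed
  then show "\<exists>N. \<forall>n\<ge>N. padic_abs p (X n * Y n) < e" by blast
qed

lemma padic_cauchy_add:
  assumes "padic_cauchy p X" "padic_cauchy p Y"
  shows "padic_cauchy p (\<lambda>n. X n + Y n)"
  unfolding padic_cauchy_def
proof (intro allI impI)
  fix e :: real assume e: "e > 0"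
  obtain M where M: "\<forall>m\<ge>M. \<forall>n\<ge>M. padic_abs p (X m - X n) < e"
    using assms(1) e unfolding padic_cauchy_def by blast
  obtain N where N: "\<forall>m\<ge>N. \<forall>n\<ge>N. padic_abs p (Y m - Y n) < e"
    using assms(2) e unfolding padic_cauchy_def by blast
  have "padic_abs p (X m + Y m - (X n + Y n)) < e" if "m \<ge> max M N" "n \<ge> max M N" for m n
    using padic_abs_add_less[OF p, of "X m - X n" e "Y m - Y n"] M N that
    by (simp add: algebra_simps)
  then show "\<exists>N. \<forall>m\<ge>N. \<forall>n\<ge>N. padic_abs p (X m + Y m - (X n + Y n)) < e" by blast
qed

lemma padic_cauchy_minus: "padic_cauchy p X \<Longrightarrow> padic_cauchy p (\<lambda>n. - X n)"
  unfolding padic_cauchy_def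
  by (metis minus_diff_minus padic_abs_minus[OF p])

lemma padic_cauchy_bounded:
  assumes "padic_cauchy p X"
  obtains B N where "B > 0" "\<forall>n\<ge>N. padic_abs p (X n) \<le> B"
proof -
  obtain N where N: "\<forall>m\<ge>N. \<forall>n\<ge>N. padic_abs p (X m - X n) < 1"
    using assms[unfolded padic_cauchy_def, rule_format, of 1] by auto
  have "padic_abs p (X n) \<le> 1 + padic_abs p (X N)" if "n \<ge> N" for n
    using padic_abs_triangle[OF p, of "X n - X N" "X N"] N that
    by (smt (verit) diff_add_cancel order_refl)
  moreover have "1 + padic_abs p (X N) > 0"
    using padic_abs_nonneg[OF p, of "X N"] by linarith
  ultimately show thesis using that by blast
qed

lemma padic_cauchy_mult:
  assumes X: "padic_cauchy p X" and Y: "padic_cauchy p Y"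
  shows "padic_cauchy p (\<lambda>n. X n * Y n)"
  unfolding padic_cauchy_def
proof (intro allI impI)
  fix e :: real assume e: "e > 0"
  obtain B K where B: "B > 0" "\<forall>n\<ge>K. padic_abs p (X n) \<le> B"
    using padic_cauchy_bounded[OF X] .
  obtain C L where C: "C > 0" "\<forall>n\<ge>L. padic_abs p (Y n) \<le> C"
    using padic_cauchy_bounded[OF Y] .
  have "e / C > 0" "e / B > 0" using e B C by auto
  then obtain M N where M: "\<forall>m\<ge>M. \<forall>n\<ge>M. padic_abs p (X m - X n) < e / C"
    and N: "\<forall>m\<ge>N. \<forall>n\<ge>N. padic_abs p (Y m - Y n) < e / B"
    using X Y unfolding padic_cauchy_def by meson
  let ?R = "max (max K L) (max M N)"
  have "padic_abs p (X m * Y m - X n * Y n) < e" if mn: "m \<ge> ?R" "n \<ge> ?R" for m n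
  proof -
    have "padic_abs p ((X m - X n) * Y m) \<le> padic_abs p (X m - X n) * C"
      unfolding padic_abs_mult[OF p] using C mn by (intro mult_left_mono) (auto simp: p)
    also have "\<dots> < e" using M mn C(1) by (simp add: field_simps)
    finally have 1: "padic_abs p ((X m - X n) * Y m) < e" .
    have "padic_abs p (X n * (Y m - Y n)) \<le> B * padic_abs p (Y m - Y n)"
      unfolding padic_abs_mult[OF p] using B mn by (intro mult_right_mono) (auto simp: p)
    also have "\<dots> < e" using N mn B(1) by (simp add: field_simps)
    finally have 2: "padic_abs p (X n * (Y m - Y n)) < e" .
    show ?thesis
      using padic_abs_add_less[OF p 1 2] by (simp add: algebra_simps)
  qed
  then show "\<exists>N. \<forall>m\<ge>N. \<forall>n\<ge>N. padic_abs p (X m * Y m - X n * Y n) < e" by blast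
qed

lemma padic_cauchy_not_null:
  assumes X: "padic_cauchy p X" and "\<not> padic_null p X"
  obtains b N where "b > 0" "\<forall>n\<ge>N. padic_abs p (X n) \<ge> b"
proof -
  obtain e where e: "e > 0" "\<forall>N. \<exists>n\<ge>N. padic_abs p (X n) \<ge> e"
    using assms(2) unfolding padic_null_def by (meson not_less)
  obtain N where N: "\<forall>m\<ge>N. \<forall>n\<ge>N. padic_abs p (X m - X n) < e"
    using X e(1) unfolding padic_cauchy_def by blast
  obtain k where k: "k \<ge> N" "padic_abs p (X k) \<ge> e" using e(2) by blast
  have "padic_abs p (X n) \<ge> e" if "n \<ge> N" for n
  proof (rule ccontr)
    assume "\<not> ?thesis"
    then have "padic_abs p (X k - X n + X n) < e"
      using N k(1) that by (intro padic_abs_add_less[OF p]) auto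
    then show False using k(2) by simp
  qed
  then show thesis using that e(1) by blast
qed

lemma padic_abs_inverse_diff_le:
  assumes "b > 0" "padic_abs p x \<ge> b" "c > 0" "padic_abs p y \<ge> c"
  shows "padic_abs p (inverse x - inverse y) \<le> padic_abs p (x - y) / (b * c)"
proof -
  have nz: "x \<noteq> 0" "y \<noteq> 0" using assms by auto
  have "inverse x - inverse y = (y - x) * (inverse x * inverse y)"
    using nz by (simp add: field_simps)
  then have "padic_abs p (inverse x - inverse y)
      = padic_abs p (y - x) * inverse (padic_abs p x * padic_abs p y)"
    by (simp add: padic_abs_mult[OF p] padic_abs_inverse[OF p])
  also have "\<dots> \<le> padic_abs p (y - x) * inverse (b * c)"
    using assms by (intro mult_left_mono le_imp_inverse_le mult_mono mult_pos_pos) (auto simp: p)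
  finally show ?thesis
    by (simp add: divide_inverse padic_abs_minus_commute[OF p, of x])
qed

lemma padic_cauchy_inverse:
  assumes X: "padic_cauchy p X" and "\<not> padic_null p X"
  shows "padic_cauchy p (\<lambda>n. inverse (X n))"
  unfolding padic_cauchy_def
proof (intro allI impI)
  fix e :: real assume e: "e > 0"
  obtain b M where b: "b > 0" "\<forall>n\<ge>M. padic_abs p (X n) \<ge> b"
    using padic_cauchy_not_null[OF assms] .
  have "e * (b * b) > 0" using e b(1) by simp
  then obtain N where N: "\<forall>m\<ge>N. \<forall>n\<ge>N. padic_abs p (X m - X n) < e * (b * b)"
    using X unfolding padic_cauchy_def by blast
  have "padic_abs p (inverse (X m) - inverse (X n)) < e" if "m \<ge> max M N" "n \<ge> max M N" for m n
  proof -
    have "padic_abs p (inverse (X m) - inverse (X n)) \<le> padic_abs p (X m - X n) / (b * b)"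
      using b that by (intro padic_abs_inverse_diff_le) auto
    also have "\<dots> < e" using N that b(1) by (simp add: pos_divide_less_eq)
    finally show ?thesis .
  qed
  then show "\<exists>N. \<forall>m\<ge>N. \<forall>n\<ge>N. padic_abs p (inverse (X m) - inverse (X n)) < e" by blast
qed

lemma padic_null_inverse_diff:
  assumes X: "padic_cauchy p X" "\<not> padic_null p X"
    and Y: "padic_cauchy p Y" "\<not> padic_null p Y"
    and XY: "padic_null p (\<lambda>n. X n - Y n)"
  shows "padic_null p (\<lambda>n. inverse (X n) - inverse (Y n))"
  unfolding padic_null_def
proof (intro allI impI)
  fix e :: real assume e: "e > 0"
  obtain b L where b: "b > 0" "\<forall>n\<ge>L. padic_abs p (X n) \<ge> b"
    using padic_cauchy_not_null[OF X] .
  obtain c M where c: "c > 0" "\<forall>n\<ge>M. padic_abs p (Y n) \<ge> c"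
    using padic_cauchy_not_null[OF Y] .
  have "e * (b * c) > 0" using e b(1) c(1) by simp
  then obtain N where N: "\<forall>n\<ge>N. padic_abs p (X n - Y n) < e * (b * c)"
    using XY unfolding padic_null_def by blast
  have "padic_abs p (inverse (X n) - inverse (Y n)) < e" if "n \<ge> max L (max M N)" for n
  proof -
    have "padic_abs p (inverse (X n) - inverse (Y n)) \<le> padic_abs p (X n - Y n) / (b * c)"
      using b c that by (intro padic_abs_inverse_diff_le) auto
    also have "\<dots> < e" using N that b(1) c(1) by (simp add: pos_divide_less_eq)
    finally show ?thesis .
  qed
  then show "\<exists>N. \<forall>n\<ge>N. padic_abs p (inverse (X n) - inverse (Y n)) < e" by blast
qed

lemma padic_rel_refl_iff: "padic_rel p X X \<longleftrightarrow> padic_cauchy p X"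
  by (auto simp: padic_rel_def padic_null_def)

lemma padic_rel_of_eq: "padic_cauchy p X \<Longrightarrow> X = Y \<Longrightarrow> padic_rel p X Y"
  by (simp add: padic_rel_refl_iff)

lemma part_equivp_padic_rel: "part_equivp (padic_rel p)"
proof (rule part_equivpI)
  show "\<exists>X. padic_rel p X X"
    using padic_rel_refl_iff padic_cauchy_const by blast
  show "symp (padic_rel p)"
    by (auto intro!: sympI simp: padic_rel_def dest: padic_null_diff_commute)
  show "transp (padic_rel p)"
  proof (rule transpI)
    fix X Y Z assume "padic_rel p X Y" "padic_rel p Y Z"
    then show "padic_rel p X Z"
      using padic_null_add[of "\<lambda>n. X n - Y n" "\<lambda>n. Y n - Z n"]
      by (simp add: padic_rel_def)
  qed
qed

end


section \<open>The field of \<open>p\<close>-adic numbers\<close>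

text \<open>
  \<open>'p padic\<close> is the completion of the rationals with respect to the \<open>p\<close>-adic absolute value,
  where \<open>p = CARD('p)\<close>. The index type \<open>'p\<close> plays no other role; as every prime number is the
  cardinality of some type of class \<open>prime_card\<close>, every field of \<open>p\<close>-adic numbers arises.
\<close>

typedef (overloaded) 'p padic =
  "{C. \<exists>X. padic_rel CARD('p::prime_card) X X \<and> C = Collect (padic_rel CARD('p) X)}"
  morphisms padic_class Abs_padic_class
  using padic_rel_refl_iff[OF prime_card] padic_cauchy_const[OF prime_card] by blast

definition abs_padic :: "(nat \<Rightarrow> rat) \<Rightarrow> 'p::prime_card padic" where
  "abs_padic = quot_type.abs (padic_rel CARD('p)) Abs_padic_class"

definition rep_padic :: "'p::prime_card padic \<Rightarrow> nat \<Rightarrow> rat" where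
  "rep_padic = quot_type.rep padic_class"

definition cr_padic :: "(nat \<Rightarrow> rat) \<Rightarrow> 'p::prime_card padic \<Rightarrow> bool" where
  "cr_padic = (\<lambda>X x. padic_rel CARD('p) X X \<and> abs_padic X = x)"

lemma Quotient_padic:
  "Quotient (padic_rel CARD('p)) (abs_padic :: _ \<Rightarrow> 'p::prime_card padic) rep_padic cr_padic"
proof -
  have "quot_type (padic_rel CARD('p)) (Abs_padic_class :: _ \<Rightarrow> 'p padic) padic_class"
    using padic_class Abs_padic_class_inverse
    by unfold_locales
      (auto simp: part_equivp_padic_rel[OF prime_card] padic_class_inverse padic_class_inject)
  then have "Quotient3 (padic_rel CARD('p)) (abs_padic :: _ \<Rightarrow> 'p padic) rep_padic"
    unfolding abs_padic_def rep_padic_def by (rule quot_type.Quotient)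
  then show ?thesis
    by (rule Quotient3_to_Quotient) (simp add: cr_padic_def)
qed

setup_lifting Quotient_padic

instantiation padic :: (prime_card) field
begin

lift_definition zero_padic :: "'a padic" is "\<lambda>_. 0"
  by (simp add: padic_rel_refl_iff[OF prime_card] padic_cauchy_const[OF prime_card])

lift_definition one_padic :: "'a padic" is "\<lambda>_. 1"
  by (simp add: padic_rel_refl_iff[OF prime_card] padic_cauchy_const[OF prime_card])

lift_definition plus_padic :: "'a padic \<Rightarrow> 'a padic \<Rightarrow> 'a padic" is "\<lambda>X Y n. X n + Y n"
  using padic_null_add[OF prime_card[where 'a='a]]
  by (simp add: padic_rel_def padic_cauchy_add[OF prime_card] add_diff_add)

lift_definition uminus_padic :: "'a padic \<Rightarrow> 'a padic" is "\<lambda>X n. - X n"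
  using padic_null_minus[OF prime_card[where 'a='a]]
  by (simp only: padic_rel_def padic_cauchy_minus[OF prime_card] minus_diff_minus simp_thms)

lift_definition times_padic :: "'a padic \<Rightarrow> 'a padic \<Rightarrow> 'a padic" is "\<lambda>X Y n. X n * Y n"
proof -
  fix X X' Y Y' :: "nat \<Rightarrow> rat"
  let ?p = "CARD('a)"
  assume XX: "padic_rel ?p X X'" and YY: "padic_rel ?p Y Y'"
  note pr = prime_card[where 'a='a]
  obtain B M where B: "B > 0" "\<forall>n\<ge>M. padic_abs ?p (Y n) \<le> B"
    using padic_cauchy_bounded[OF pr] YY unfolding padic_rel_def by blast
  obtain C N where C: "C > 0" "\<forall>n\<ge>N. padic_abs ?p (X' n) \<le> C"
    using padic_cauchy_bounded[OF pr] XX unfolding padic_rel_def by blast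
  have "padic_null ?p (\<lambda>n. (X n - X' n) * Y n + (Y n - Y' n) * X' n)"
    using XX YY B C unfolding padic_rel_def
    by (intro padic_null_add[OF pr] padic_null_mult_bounded[OF pr]) auto
  moreover have "(\<lambda>n. (X n - X' n) * Y n + (Y n - Y' n) * X' n) = (\<lambda>n. X n * Y n - X' n * Y' n)"
    by (auto simp: algebra_simps)
  ultimately show "padic_rel ?p (\<lambda>n. X n * Y n) (\<lambda>n. X' n * Y' n)"
    using XX YY by (simp add: padic_rel_def padic_cauchy_mult[OF pr])
qed

lift_definition inverse_padic :: "'a padic \<Rightarrow> 'a padic"
  is "\<lambda>X. if padic_null CARD('a) X then (\<lambda>_. 0) else (\<lambda>n. inverse (X n))"
proof -
  fix X Y :: "nat \<Rightarrow> rat"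
  let ?p = "CARD('a)"
  note pr = prime_card[where 'a='a]
  assume "padic_rel ?p X Y"
  then have X: "padic_cauchy ?p X" and Y: "padic_cauchy ?p Y"
    and XY: "padic_null ?p (\<lambda>n. X n - Y n)"
    by (simp_all add: padic_rel_def)
  have "padic_null ?p X \<longleftrightarrow> padic_null ?p Y"
    using padic_null_diff[OF pr _ XY, of X] padic_null_add[OF pr XY, of Y] by auto
  then show "padic_rel ?p (if padic_null ?p X then \<lambda>_. 0 else (\<lambda>n. inverse (X n)))
                          (if padic_null ?p Y then \<lambda>_. 0 else (\<lambda>n. inverse (Y n)))"
    using X Y XY
    by (simp add: padic_rel_def padic_cauchy_inverse[OF pr] padic_null_inverse_diff[OF pr]
        padic_cauchy_const[OF pr] padic_null_const_iff[OF pr])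
qed

definition minus_padic :: "'a padic \<Rightarrow> 'a padic \<Rightarrow> 'a padic" where
  "minus_padic x y = x + - y"

definition divide_padic :: "'a padic \<Rightarrow> 'a padic \<Rightarrow> 'a padic" where
  "divide_padic x y = x * inverse y"

instance
proof
  note pr = prime_card[where 'a='a]
  note cl = padic_cauchy_add[OF pr] padic_cauchy_mult[OF pr] padic_cauchy_minus[OF pr]
    padic_cauchy_const[OF pr]
  note eqI = padic_rel_of_eq[OF pr]
  fix a b c :: "'a padic"
  show "a + b = b + a"
    by transfer (auto intro!: eqI cl simp: padic_rel_refl_iff[OF pr] ac_simps)
  show "(a + b) + c = a + (b + c)"
    by transfer (auto intro!: eqI cl simp: padic_rel_refl_iff[OF pr] ac_simps)
  show "0 + a = a"
    by transfer (auto intro!: eqI cl simp: padic_rel_refl_iff[OF pr])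
  show "- a + a = 0"
    by transfer (auto intro!: eqI cl simp: padic_rel_refl_iff[OF pr])
  show "a - b = a + - b"
    by (rule minus_padic_def)
  show "(a * b) * c = a * (b * c)"
    by transfer (auto intro!: eqI cl simp: padic_rel_refl_iff[OF pr] ac_simps)
  show "a * b = b * a"
    by transfer (auto intro!: eqI cl simp: padic_rel_refl_iff[OF pr] ac_simps)
  show "1 * a = a"
    by transfer (auto intro!: eqI cl simp: padic_rel_refl_iff[OF pr])
  show "(a + b) * c = a * c + b * c"
    by transfer (auto intro!: eqI cl simp: padic_rel_refl_iff[OF pr] distrib_right)
  show "(0::'a padic) \<noteq> 1"
    by transfer (simp add: padic_rel_def padic_null_const_iff[OF pr])
  have inv: "padic_rel CARD('a) (\<lambda>n. inverse (X n) * X n) (\<lambda>_. 1)"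
    if X: "padic_cauchy CARD('a) X" "\<not> padic_null CARD('a) X" for X
  proof -
    obtain b N where bN: "b > 0" "\<forall>n\<ge>N. padic_abs CARD('a) (X n) \<ge> b"
      using padic_cauchy_not_null[OF pr X] .
    then have "X n \<noteq> 0" if "n \<ge> N" for n using that by fastforce
    then have "padic_null CARD('a) (\<lambda>n. inverse (X n) * X n - 1)"
      unfolding padic_null_def by (intro allI impI exI[of _ N]) auto
    then show ?thesis
      using X by (simp add: padic_rel_def cl padic_cauchy_inverse[OF pr])
  qed
  show "a \<noteq> 0 \<Longrightarrow> inverse a * a = 1"
    by transfer (use inv in \<open>auto simp: padic_rel_def padic_cauchy_const[OF pr]\<close>)
  show "a div b = a * inverse b"
    by (rule divide_padic_def)
  show "inverse (0::'a padic) = 0"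
    by transfer (simp add: padic_rel_refl_iff[OF pr] cl padic_null_const_iff[OF pr])
qed

end

instance padic :: (prime_card) field_char_0
proof
  note pr = prime_card[where 'a='a]
  have of_nat: "(of_nat n :: 'a padic) = abs_padic (\<lambda>_. of_nat n)" for n
  proof (induction n)
    case 0
    show ?case by (simp add: zero_padic_def)
  next
    case (Suc n)
    have "(1 :: 'a padic) + abs_padic (\<lambda>_. of_nat n) = abs_padic (\<lambda>_. 1 + of_nat n)"
      unfolding one_padic_def
      by (rule plus_padic.abs_eq)
        (simp_all add: padic_rel_refl_iff[OF pr] padic_cauchy_const[OF pr])
    then show ?case using Suc by simp
  qed
  show "inj (of_nat :: nat \<Rightarrow> 'a padic)"
  proof (rule injI)
    fix m n assume "(of_nat m :: 'a padic) = of_nat n"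
    then have "padic_rel CARD('a) (\<lambda>_. of_nat m) (\<lambda>_. of_nat n)"
      using Quotient_rel[OF Quotient_padic[where 'p='a], symmetric]
      by (simp add: of_nat padic_rel_refl_iff[OF pr] padic_cauchy_const[OF pr])
    then show "m = n"
      by (simp add: padic_rel_def padic_null_const_iff[OF pr])
  qed
qed


section \<open>The auxiliary system\<close>

text \<open>
  The indices \<open>1 \<le> i \<le> s\<close> become \<open>0 \<le> i < s\<close> throughout; the degrees \<open>j\<close> keep the range \<open>{1..k}\<close>,
  except that row \<open>r\<close> of the Jacobian matrix belongs to \<open>j = r + 1\<close>.
\<close>

definition no_vanishing_subsums :: "nat \<Rightarrow> nat \<Rightarrow> int vec \<Rightarrow> int vec \<Rightarrow> bool" where
  "no_vanishing_subsums k s c y \<longleftrightarrow>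
     (\<forall>I \<subseteq> {..<s}. I \<noteq> {} \<longrightarrow> (\<Sum>i\<in>I. c $ i * (y $ i) ^ k) \<noteq> 0)"

definition is_solution :: "nat \<Rightarrow> nat \<Rightarrow> int vec \<Rightarrow> int vec \<Rightarrow> 'a::field vec \<Rightarrow> bool" where
  "is_solution k s c y z \<longleftrightarrow> z \<in> carrier_vec s \<and>
     (\<forall>j\<in>{1..k}. (\<Sum>i<s. of_int (c $ i) * of_int (y $ i) ^ (k - j) * (z $ i) ^ j) = 0)"

definition jacobian :: "nat \<Rightarrow> nat \<Rightarrow> int vec \<Rightarrow> int vec \<Rightarrow> 'a::field vec \<Rightarrow> 'a mat" where
  "jacobian k s c y z = mat k s (\<lambda>(r, i).
     of_nat (r + 1) * of_int (c $ i) * of_int (y $ i) ^ (k - (r + 1)) * (z $ i) ^ r)"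

definition nonsingular_solution :: "nat \<Rightarrow> nat \<Rightarrow> int vec \<Rightarrow> int vec \<Rightarrow> 'a::field vec \<Rightarrow> bool" where
  "nonsingular_solution k s c y z \<longleftrightarrow>
     is_solution k s c y z \<and> vec_space.rank k (jacobian k s c y z) = k"

end

theory Submission
  imports Defs
begin

text \<open>
  Put \<open>t\<^sub>i = z\<^sub>i / y\<^sub>i\<close> and \<open>w\<^sub>i = c\<^sub>i y\<^sub>i\<^sup>k\<close>, so that the system says that the power moments
  \<open>\<Sum> w\<^sub>i t\<^sub>i\<^sup>j\<close> vanish for \<open>1 \<le> j \<le> k\<close>, while the Jacobian is, up to nonzero row and
  column factors, the Vandermonde matrix \<open>(t\<^sub>i\<^sup>r)\<close>. It has rank \<open>k\<close> as soon as the \<open>t\<^sub>i\<close> take \<open>k\<close>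
  distinct values. If they take fewer, then for every value \<open>u \<noteq> 0\<close> some polynomial of degree at
  most \<open>k\<close> without constant term vanishes at all \<open>t\<^sub>i\<close> except those equal to \<open>u\<close>; hence the \<open>w\<^sub>i\<close>
  with \<open>t\<^sub>i = u\<close> sum to \<open>0\<close>. This is a vanishing subsum, and if no \<open>t\<^sub>i\<close> is zero, adding these
  subsums up gives \<open>n = 0\<close>.
\<close>

lemma (in vec_space) rank_le_nr:
  assumes "A \<in> carrier_mat n nc"
  shows "rank A \<le> n"
proof -
  let ?P = "\<lambda>T. T \<subseteq> set (cols A) \<and> lin_indpt T"
  have "lin_indpt {}" by (simp add: lin_dep_def)
  then obtain S where S: "maximal S ?P"
    using maximal_exists_superset[of "set (cols A)" ?P "{}"] by blast
  then have "S \<subseteq> set (cols A)" and li: "lin_indpt S"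
    by (simp_all add: maximal_def)
  moreover have "set (cols A) \<subseteq> carrier_vec n"
    using cols_dim[of A] assms by simp
  ultimately have "S \<subseteq> carrier_vec n" by blast
  then have "card S \<le> n"
    using li_le_dim(2)[OF fin_dim _ li] by (simp add: dim_is_n)
  then show ?thesis using rank_card_indpt[OF assms S] by simp
qed

text \<open>The columns of a nonsingular minor are \<open>n\<close> independent columns of
  \<open>A\<close>, which bounds the rank from below. Injectivity of \<open>f\<close> need not be
  assumed: a repeated column would make the determinant zero.\<close>

lemma (in vec_space) rank_eq_nr_if_minor:
  assumes A: "A \<in> carrier_mat n nc"
    and f: "\<And>j. j < n \<Longrightarrow> f j < nc"
    and det: "det (mat n n (\<lambda>(i, j). A $$ (i, f j))) \<noteq> 0"
  shows "rank A = n"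
proof -
  define B where "B = mat n n (\<lambda>(i, j). A $$ (i, f j))"
  have B: "B \<in> carrier_mat n n" by (simp add: B_def)
  have rank: "rank B = n"
    using low_rank_det_zero[OF B] det by (simp add: B_def)
  then have dist: "distinct (cols B)"
    using non_distinct_low_rank[OF B] by auto
  have "col B j = col A (f j)" if "j < n" for j
    using that A f[OF that] by (intro eq_vecI) (auto simp: B_def)
  then have "set (cols B) \<subseteq> set (cols A)"
    using A B f by (auto simp: cols_def)
  then have "card (set (cols B)) \<le> rank A"
    using rank_ge_card_indpt[OF A] full_rank_lin_indpt[OF B rank dist] by blast
  then show ?thesis
    using rank_le_nr[OF A] distinct_card[OF dist] B by simp
qed

lemma poly_eq_0_if_many_roots:
  fixes P :: "'a::idom poly"
  assumes "degree P < card S" "\<And>x. x \<in> S \<Longrightarrow> poly P x = 0"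
  shows "P = 0"
proof (rule ccontr)
  assume P: "P \<noteq> 0"
  then have "card S \<le> card {x. poly P x = 0}"
    using assms(2) by (intro card_mono poly_roots_finite) auto
  then show False using card_poly_roots_bound[OF P] assms(1) by simp
qed

text \<open>A kernel vector of the transpose, scaled by the row factors, is the coefficient vector
  of a polynomial of degree below \<open>k\<close> with the \<open>k\<close> distinct roots
  \<open>t i\<close>; the column factors cancel.\<close>

lemma det_scaled_vandermonde_nonzero:
  fixes a b t :: "nat \<Rightarrow> 'a::field"
  assumes a: "\<And>r. r < k \<Longrightarrow> a r \<noteq> 0" and b: "\<And>i. i < k \<Longrightarrow> b i \<noteq> 0"
    and t: "inj_on t {..<k}"
  shows "det (mat k k (\<lambda>(r, i). a r * b i * t i ^ r)) \<noteq> 0"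
proof
  let ?B = "mat k k (\<lambda>(r, i). a r * b i * t i ^ r)"
  assume "det ?B = 0"
  then have "det (transpose_mat ?B) = 0" by (subst det_transpose[of _ k]) auto
  then obtain v where v: "v \<in> carrier_vec k" "v \<noteq> 0\<^sub>v k"
      and v0: "transpose_mat ?B *\<^sub>v v = 0\<^sub>v k"
    using det_0_iff_vec_prod_zero_field[of "transpose_mat ?B" k] by auto
  define P where "P = (\<Sum>r<k. Polynomial.monom (a r * v $ r) r)"
  have coeff: "Polynomial.coeff P r = (if r < k then a r * v $ r else 0)" for r
    by (simp add: P_def coeff_sum)
  have root: "poly P (t i) = 0" if i: "i < k" for i
  proof -
    have "0 = (transpose_mat ?B *\<^sub>v v) $ i" using v0 i by simp
    also have "\<dots> = (\<Sum>r<k. a r * b i * t i ^ r * v $ r)"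
      using i v(1) by (simp add: scalar_prod_def atLeast0LessThan)
    also have "\<dots> = b i * poly P (t i)"
      by (simp add: P_def poly_sum poly_monom sum_distrib_left mult_ac)
    finally show ?thesis using b[OF i] by simp
  qed
  \<comment> \<open>The zero polynomial has degree 0, so the degree bound needs
    \<open>k > 0\<close>.\<close>
  have "k > 0" using v by (cases k) auto
  then have "degree P < k"
    by (metis coeff leading_coeff_0_iff degree_0)
  then have "P = 0"
    using root t by (intro poly_eq_0_if_many_roots[of _ "t ` {..<k}"]) (auto simp: card_image)
  then have "v $ r = 0" if "r < k" for r
    using coeff[of r] a[OF that] that by simp
  then have "v = 0\<^sub>v k" using v(1) by (intro eq_vecI) auto
  then show False using v(2) by simp
qed

lemma rank_scaled_vandermonde:
  fixes a b t :: "nat \<Rightarrow> 'a::field"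
  assumes a: "\<And>r. r < k \<Longrightarrow> a r \<noteq> 0" and b: "\<And>i. i < s \<Longrightarrow> b i \<noteq> 0"
    and k: "k \<le> card (t ` {..<s})"
  shows "vec_space.rank k (mat k s (\<lambda>(r, i). a r * b i * t i ^ r)) = k"
proof -
  obtain S where S: "S \<subseteq> t ` {..<s}" "card S = k" "finite S"
    using obtain_subset_with_card_n[OF k] by blast
  \<comment> \<open>\<open>I\<close> takes one index for each of \<open>k\<close> chosen values of
    \<open>t\<close>, so its columns form a square Vandermonde minor with distinct nodes.\<close>
  then obtain I where I: "I \<subseteq> {..<s}" "inj_on t I" "S = t ` I"
    using subset_image_inj[of S t "{..<s}"] by blast
  then have "card I = k" "finite I"
    using S(2) card_image[of t I] finite_subset[of I "{..<s}"] by auto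
  then obtain f where f: "bij_betw f {..<k} I"
    using ex_bij_betw_nat_finite[of I] by (auto simp: atLeast0LessThan)
  have fs: "f j < s" if "j < k" for j
    using bij_betwE[OF f] I(1) that by auto
  have "inj_on (\<lambda>j. t (f j)) {..<k}"
    using comp_inj_on[of f "{..<k}" t] f I(2) by (auto simp: bij_betw_def comp_def)
  then have "det (mat k k (\<lambda>(r, j). a r * b (f j) * t (f j) ^ r)) \<noteq> 0"
    using det_scaled_vandermonde_nonzero[of k a "\<lambda>j. b (f j)" "\<lambda>j. t (f j)"] a b fs by auto
  also have "mat k k (\<lambda>(r, j). a r * b (f j) * t (f j) ^ r)
      = mat k k (\<lambda>(r, j). mat k s (\<lambda>(r, i). a r * b i * t i ^ r) $$ (r, f j))"
    using fs by (intro eq_matI) auto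
  finally show ?thesis
    using fs by (intro vec_space.rank_eq_nr_if_minor[of _ _ s f]) auto
qed

lemma fibre_sum_eq_0_if_moments_vanish:
  fixes w t :: "'i \<Rightarrow> 'a::idom"
  assumes I: "finite I" and k: "card (t ` I) \<le> k"
    and moments: "\<And>j. 1 \<le> j \<Longrightarrow> j \<le> k \<Longrightarrow> (\<Sum>i\<in>I. w i * t i ^ j) = 0"
    and u: "u \<noteq> 0"
  shows "(\<Sum>i | i \<in> I \<and> t i = u. w i) = 0"
proof (cases "u \<in> t ` I")
  case True
  \<comment> \<open>The factor X removes the constant term, since no moment of order 0 is given. It
    takes the place of the omitted factor for \<open>u\<close>, so the degree is just the number of
    values; and \<open>R\<close> is nonzero at \<open>u\<close> because \<open>u\<close> is
    nonzero.\<close>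
  define R where "R = [:0, 1:] * (\<Prod>x\<in>t ` I - {u}. [:- x, 1:])"
  have nz: "(\<Prod>x\<in>t ` I - {u}. [:- x, 1:]) \<noteq> 0"
    using I by simp
  have "degree R = 1 + (\<Sum>x\<in>t ` I - {u}. degree [:- x, 1:])"
    unfolding R_def by (subst degree_mult_eq) (use nz in \<open>auto simp: degree_prod_eq_sum_degree\<close>)
  also have "\<dots> = card (t ` I)"
    using card_Suc_Diff1[OF finite_imageI[OF I] True] by simp
  finally have degree: "degree R \<le> k" using k by simp
  have Ru: "poly R u \<noteq> 0"
    using u I by (auto simp: R_def poly_prod)
  have Rx: "poly R (t i) = 0" if "i \<in> I" "t i \<noteq> u" for i
    using that I by (auto simp: R_def poly_prod)
  have "poly R u * (\<Sum>i | i \<in> I \<and> t i = u. w i) = (\<Sum>i | i \<in> I \<and> t i = u. w i * poly R (t i))"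
    unfolding sum_distrib_left by (intro sum.cong) (auto simp: mult.commute)
  also have "\<dots> = (\<Sum>i\<in>I. w i * poly R (t i))"
    using I Rx by (intro sum.mono_neutral_left) auto
  also have "\<dots> = (\<Sum>i\<in>I. \<Sum>j\<le>degree R. Polynomial.coeff R j * (w i * t i ^ j))"
    by (simp add: poly_altdef sum_distrib_left mult_ac)
  also have "\<dots> = (\<Sum>j\<le>degree R. Polynomial.coeff R j * (\<Sum>i\<in>I. w i * t i ^ j))"
    by (subst sum.swap) (simp add: sum_distrib_left)
  also have "\<dots> = 0"
  proof (intro sum.neutral ballI)
    fix j assume "j \<in> {..degree R}"
    then show "Polynomial.coeff R j * (\<Sum>i\<in>I. w i * t i ^ j) = 0"
      using moments[of j] degree by (cases j) (auto simp: R_def)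
  qed
  finally show ?thesis using Ru by simp
next
  case False
  then have "{i. i \<in> I \<and> t i = u} = {}" by auto
  then show ?thesis by (simp only: sum.empty)
qed

text \<open>Both choices of K are covered at once through characteristic zero, which keeps the row
  factors \<open>r + 1\<close> nonzero and lets integer sums that vanish in K vanish in the
  integers.\<close>

lemma is_solution_nonsingular:
  fixes z :: "'a::field_char_0 vec"
  assumes c: "\<forall>i<s. c $ i \<noteq> 0" and y: "\<forall>i<s. y $ i \<noteq> 0"
    and n: "(\<Sum>i<s. c $ i * (y $ i) ^ k) \<noteq> 0"
    and z: "is_solution k s c y z"
    and cases: "no_vanishing_subsums k s c y \<and> z \<noteq> 0\<^sub>v s \<or> (\<forall>i<s. z $ i \<noteq> 0)"
  shows "nonsingular_solution k s c y z"
proof -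
  define t where "t i = z $ i / of_int (y $ i)" for i
  have zt: "z $ i = of_int (y $ i) * t i" if "i < s" for i
    using y that by (simp add: t_def)
  let ?w = "\<lambda>i. c $ i * (y $ i) ^ k"
  have "k \<le> card (t ` {..<s})"
  proof (rule ccontr)
    assume few: "\<not> k \<le> card (t ` {..<s})"
    have moments: "(\<Sum>i<s. of_int (?w i) * t i ^ j) = 0" if "1 \<le> j" "j \<le> k" for j
    proof -
      have "(\<Sum>i<s. of_int (?w i) * t i ^ j)
          = (\<Sum>i<s. of_int (c $ i) * of_int (y $ i) ^ (k - j) * (z $ i) ^ j)"
        using that power_add[of "of_int (y $ i) :: 'a" "k - j" j for i]
        by (intro sum.cong) (auto simp: zt power_mult_distrib mult_ac)
      then show ?thesis using z that by (simp add: is_solution_def)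
    qed
    have fibre: "(\<Sum>i | i < s \<and> t i = u. ?w i) = 0" if "u \<noteq> 0" for u
    proof -
      have "of_int (\<Sum>i | i < s \<and> t i = u. ?w i) = (0 :: 'a)"
        using fibre_sum_eq_0_if_moments_vanish[of "{..<s}" t k "\<lambda>i. of_int (?w i)" u]
          few moments that by simp
      then show ?thesis by (simp only: of_int_eq_0_iff)
    qed
    show False
      using cases
    proof
      assume nv: "no_vanishing_subsums k s c y \<and> z \<noteq> 0\<^sub>v s"
      then obtain i where i: "i < s" "z $ i \<noteq> 0"
        using z by (metis is_solution_def carrier_vecD eq_vecI index_zero_vec)
      then have "t i \<noteq> 0" using zt by auto
      \<comment> \<open>The fibre of \<open>t\<close> through \<open>i\<close> contains
        \<open>i\<close>, so it is a nonempty index set with vanishing subsum.\<close>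
      then show False
        using fibre[of "t i"] nv i(1) unfolding no_vanishing_subsums_def
        by (metis (mono_tags, lifting) empty_iff lessThan_iff mem_Collect_eq subsetI)
    next
      assume nz: "\<forall>i<s. z $ i \<noteq> 0"
      have "(\<Sum>i<s. ?w i) = (\<Sum>u\<in>t ` {..<s}. \<Sum>i | i \<in> {..<s} \<and> t i = u. ?w i)"
        by (rule sum.image_gen) simp
      also have "\<dots> = 0"
        using fibre nz y by (intro sum.neutral) (auto simp: t_def)
      finally show False using n by simp
    qed
  qed
  then have "vec_space.rank k (mat k s (\<lambda>(r, i).
      of_nat (r + 1) * (of_int (c $ i) * of_int (y $ i) ^ (k - 1)) * t i ^ r)) = k"
    using c y by (intro rank_scaled_vandermonde) (auto simp del: of_nat_Suc)
  also have "mat k s (\<lambda>(r, i).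
      of_nat (r + 1) * (of_int (c $ i) * of_int (y $ i) ^ (k - 1)) * t i ^ r) = jacobian k s c y z"
  proof -
    \<comment> \<open>The column factor \<open>y $ i ^ (k - 1)\<close> supplies the power
      \<open>y $ i ^ r\<close> that turns \<open>t i ^ r\<close> into \<open>z $ i ^ r\<close>;
      \<open>r < k\<close> keeps the subtraction from truncating.\<close>
    have "x ^ (k - 1) = x ^ (k - (r + 1)) * x ^ r" if "r < k" for r and x :: 'a
      using that by (simp flip: power_add)
    then show ?thesis
      by (intro eq_matI) (auto simp: jacobian_def zt power_mult_distrib)
  qed
  finally show ?thesis using z by (simp add: nonsingular_solution_def)
qed

theorem mainTheorem3:
  fixes k s :: nat and c y :: "int vec" and n :: int
  assumes "k \<ge> 3" and "s \<ge> 1"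
    and "c \<in> carrier_vec s" and "\<forall>i<s. c $ i \<noteq> 0"
    and "n \<noteq> 0"
    and "y \<in> carrier_vec s" and "\<forall>i<s. y $ i \<noteq> 0"
    and "(\<Sum>i<s. c $ i * (y $ i) ^ k) = n"
  shows
    "(\<forall>z :: real vec. is_solution k s c y z \<longrightarrow>
        (no_vanishing_subsums k s c y \<and> z \<noteq> 0\<^sub>v s \<longrightarrow> nonsingular_solution k s c y z) \<and>
        ((\<forall>i<s. z $ i \<noteq> 0) \<longrightarrow> nonsingular_solution k s c y z))
   \<and> (\<forall>z :: 'p::prime_card padic vec. is_solution k s c y z \<longrightarrow>
        (no_vanishing_subsums k s c y \<and> z \<noteq> 0\<^sub>v s \<longrightarrow> nonsingular_solution k s c y z) \<and>
        ((\<forall>i<s. z $ i \<noteq> 0) \<longrightarrow> nonsingular_solution k s c y z))"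
proof -
  have n: "(\<Sum>i<s. c $ i * (y $ i) ^ k) \<noteq> 0" using assms(5,8) by simp
  note nonsingular = is_solution_nonsingular[OF assms(4,7) n]
  show ?thesis
    by (intro conjI allI impI; rule nonsingular) simp_all
qed

end
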